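(* Assume that the impedance $t_h$ is diagonal and that the partition has no cross-point, i.e. $\Gamma_j^h\cap\Gamma_k^h\cap\Gamma_p^h=\emptyset$ and $\Gamma_j^h\cap\Gamma_k^h\cap\partial\Omega=\emptyset$ for all pairwise distinct $j,k,p\in\{1,\dots,J\}$ (respectively all $j\neq k$). Set $\mathfrak{I}:=\{(j,k)\in\{1,\dots,J\}^2: j<k,\ \Gamma_j^h\cap\Gamma_k^h\ne\emptyset\}$ and $\Gamma_0^h:=\partial\Omega$. Then $X=\Pi$ if there exist scalar products $t_h^{j,k}:V_h(\Gamma_j^h\cap\Gamma_k^h)\times V_h(\Gamma_j^h\cap\Gamma_k^h)\to\mathbb{C}$ such that $$t_h(\mathfrak{v},\mathfrak{w})=\sum_{k\in\{1,\dots,J\}}t_h^{0,k}(v_k,w_k)+\sum_{(j,k)\in\mathfrak{I}}\big(t_h^{j,k}(v_j,w_j)+t_h^{j,k}(v_k,w_k)\big)$$ for all $\mathfrak{v}=(v_1,\dots,v_J)$, $\mathfrak{w}=(w_1,\dots,w_J)\in\mathbb{V}_h(\Sigma)$.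
   Context: Let $d\in\{1,2,3\}$ and let $\Omega\subset\mathbb{R}^d$ be a bounded polygonal/polyhedral domain with a regular simplicial triangulation $\mathcal{T}_h(\Omega)$. For a fixed $k\ge1$, $V_h(\Omega)$ is the space of complex-valued continuous functions on $\overline\Omega$ that are polynomials of degree at most $k$ on each cell. $\overline\Omega=\cup_{j=1}^J\overline{\Omega}_j^h$ with pairwise disjoint polyhedral subdomains whose closures are unions of mesh cells; $\Gamma_j^h:=\partial\Omega_j^h$, $\Sigma:=\cup_j\Gamma_j^h$. For a set $\Upsilon$ (such as $\Gamma_j^h$ or $\Gamma_j^h\cap\Gamma_k^h$), $V_h(\Upsilon):=\{v|_\Upsilon: v\in V_h(\Omega)\}$. $\mathbb{V}_h(\Sigma):=V_h(\Gamma_1^h)\times\cdots\times V_h(\Gamma_J^h)$, and $V_h(\Sigma):=\{(v|_{\Gamma_1^h},\dots,v|_{\Gamma_J^h}): v\in V_h(\Omega)\}$. The impedance $t_h$ is a scalar product on $\mathbb{V}_h(\Sigma)$; it is called diagonal if there are scalar products $t_h^j$ on $V_h(\Gamma_j^h)$ with $t_h(\mathfrak{p},\mathfrak{q})=\sum_{j=1}^Jt_h^j(p_j,q_j)$. $\Pi:\mathbb{V}_h(\Sigma)\to\mathbb{V}_h(\Sigma)$ is such that $(\mathrm{Id}+\Pi)/2$ is the $t_h$-orthogonal projector onto $V_h(\Sigma)$. Under the no-cross-point condition, $X:\mathbb{V}_h(\Sigma)\to\mathbb{V}_h(\Sigma)$ is the operator swapping traces across interfaces: $\mathfrak{v}=X(\mathfrak{w})$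 iff $v_j=w_k$ on $\Gamma_j^h\cap\Gamma_k^h$ for $j\ne k$, and $v_j=w_j$ on $\Gamma_j^h\cap\partial\Omega$. In $t_h^{j,k}(v_j,w_j)$ the arguments are understood as restricted to $\Gamma_j^h\cap\Gamma_k^h$, and $t_h^{0,k}$ acts on restrictions to $\partial\Omega\cap\Gamma_k^h$ (the term being $0$ when this set is empty). *)

theory Defs
  imports "HOL-Analysis.Analysis" "HOL-Library.Function_Algebras"
begin

text \<open>
  Polyhedral open sets: the boundary is a finite union of polytopes of codimension one.
  Connectedness is not included; it is required separately of the computational domain.
\<close>

definition polyhedral_open :: "(real^'d) set \<Rightarrow> bool" where
  "polyhedral_open S \<longleftrightarrow>
     S \<noteq> {} \<and> open S \<and> bounded S \<and>
     (\<exists>\<F>. finite \<F> \<and> (\<forall>P\<in>\<F>. polytope P \<and> aff_dim P = int CARD('d) - 1) \<and> frontier S = \<Union>\<F>)"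

text \<open>
  A regular (conforming) simplicial mesh consists of finitely many closed nondegenerate
  \<open>d\<close>-simplices, any two of which meet in a common, possibly empty, face.
  The mesh contains only the top-dimensional cells.
\<close>

definition simplicial_mesh :: "(real^'d) set \<Rightarrow> (real^'d) set set \<Rightarrow> bool" where
  "simplicial_mesh \<Omega> \<T> \<longleftrightarrow>
     triangulation \<T> \<and> (\<forall>T\<in>\<T>. int CARD('d) simplex T) \<and> closure \<Omega> = \<Union>\<T>"

definition subdomain_partition ::
    "(real^'d) set \<Rightarrow> (real^'d) set set \<Rightarrow> nat \<Rightarrow> (nat \<Rightarrow> (real^'d) set) \<Rightarrow> bool" where
  "subdomain_partition \<Omega> \<T> J \<Omega>s \<longleftrightarrow>
     (\<forall>j\<in>{1..J}. polyhedral_open (\<Omega>s j) \<and> \<Omega>s j \<subseteq> \<Omega> \<and>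
        (\<exists>\<S>\<subseteq>\<T>. closure (\<Omega>s j) = \<Union>\<S>)) \<and>
     (\<forall>j\<in>{1..J}. \<forall>k\<in>{1..J}. j \<noteq> k \<longrightarrow> \<Omega>s j \<inter> \<Omega>s k = {}) \<and>
     closure \<Omega> = (\<Union>j\<in>{1..J}. closure (\<Omega>s j))"

text \<open>The boundaries, with index \<open>0\<close> standing for the boundary of the whole domain.\<close>

definition bdry :: "(real^'d) set \<Rightarrow> (nat \<Rightarrow> (real^'d) set) \<Rightarrow> nat \<Rightarrow> (real^'d) set" where
  "bdry \<Omega> \<Omega>s j = (if j = 0 then frontier \<Omega> else frontier (\<Omega>s j))"

definition no_cross_point :: "nat \<Rightarrow> (nat \<Rightarrow> (real^'d) set) \<Rightarrow> bool" where
  "no_cross_point J \<Gamma> \<longleftrightarrow>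
     (\<forall>j\<in>{1..J}. \<forall>k\<in>{1..J}. \<forall>p\<in>{1..J}.
        j \<noteq> k \<and> k \<noteq> p \<and> j \<noteq> p \<longrightarrow> \<Gamma> j \<inter> \<Gamma> k \<inter> \<Gamma> p = {}) \<and>
     (\<forall>j\<in>{1..J}. \<forall>k\<in>{1..J}. j \<noteq> k \<longrightarrow> \<Gamma> j \<inter> \<Gamma> k \<inter> \<Gamma> 0 = {})"

definition interface_pairs :: "nat \<Rightarrow> (nat \<Rightarrow> (real^'d) set) \<Rightarrow> (nat \<times> nat) set" where
  "interface_pairs J \<Gamma> = {(j, k). j \<in> {1..J} \<and> k \<in> {1..J} \<and> j < k \<and> \<Gamma> j \<inter> \<Gamma> k \<noteq> {}}"

text \<open>Complex polynomials in \<open>d\<close> real variables of total degree at most \<open>r\<close>,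
  written out in monomials indexed by multi-indices \<open>\<alpha>\<close>.\<close>

definition poly_deg_le :: "nat \<Rightarrow> (real^'d \<Rightarrow> complex) \<Rightarrow> bool" where
  "poly_deg_le r p \<longleftrightarrow>
     (\<exists>c :: ('d \<Rightarrow> nat) \<Rightarrow> complex. \<forall>x.
        p x = (\<Sum>\<alpha> | (\<Sum>i\<in>UNIV. \<alpha> i) \<le> r. c \<alpha> * (\<Prod>i\<in>UNIV. complex_of_real (x $ i) ^ \<alpha> i)))"

text \<open>
  A function on a subset of \<open>real^'d\<close> is represented by its extension by zero to the whole
  space, and a tuple indexed by \<open>{1..J}\<close> by its extension by zero to all of \<open>nat\<close>.
  Equality and the pointwise vector space operations then agree with those of functions
  on the subset, respectively of tuples; every function on the empty set is \<open>0\<close>.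
\<close>

definition restr :: "(real^'d) set \<Rightarrow> (real^'d \<Rightarrow> complex) \<Rightarrow> (real^'d \<Rightarrow> complex)" where
  "restr \<Upsilon> v = (\<lambda>x. if x \<in> \<Upsilon> then v x else 0)"

definition Vh :: "(real^'d) set \<Rightarrow> (real^'d) set set \<Rightarrow> nat \<Rightarrow> (real^'d \<Rightarrow> complex) set" where
  "Vh \<Omega> \<T> r =
     {v. continuous_on (closure \<Omega>) v \<and>
         (\<forall>T\<in>\<T>. \<exists>p. poly_deg_le r p \<and> (\<forall>x\<in>T. v x = p x)) \<and>
         (\<forall>x. x \<notin> closure \<Omega> \<longrightarrow> v x = 0)}"

definition Vh_on ::
    "(real^'d) set \<Rightarrow> (real^'d) set set \<Rightarrow> nat \<Rightarrow> (real^'d) set \<Rightarrow> (real^'d \<Rightarrow> complex) set" where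
  "Vh_on \<Omega> \<T> r \<Upsilon> = restr \<Upsilon> ` Vh \<Omega> \<T> r"

definition multi_trace ::
    "(real^'d) set \<Rightarrow> (real^'d) set set \<Rightarrow> nat \<Rightarrow> nat \<Rightarrow> (nat \<Rightarrow> (real^'d) set)
      \<Rightarrow> (nat \<Rightarrow> real^'d \<Rightarrow> complex) set" where
  "multi_trace \<Omega> \<T> r J \<Gamma> =
     {p. (\<forall>j\<in>{1..J}. p j \<in> Vh_on \<Omega> \<T> r (\<Gamma> j)) \<and> (\<forall>j. j \<notin> {1..J} \<longrightarrow> p j = 0)}"

definition single_trace ::
    "(real^'d) set \<Rightarrow> (real^'d) set set \<Rightarrow> nat \<Rightarrow> nat \<Rightarrow> (nat \<Rightarrow> (real^'d) set)
      \<Rightarrow> (nat \<Rightarrow> real^'d \<Rightarrow> complex) set" where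
  "single_trace \<Omega> \<T> r J \<Gamma> =
     (\<lambda>v j. if j \<in> {1..J} then restr (\<Gamma> j) v else 0) ` Vh \<Omega> \<T> r"

text \<open>
  Scalar products on a complex vector space \<open>V\<close> with scalar multiplication \<open>smul\<close>:
  Hermitian positive definite forms, linear in the first and hence antilinear in the second
  argument.  All spaces \<open>V\<close> considered are closed under the operations.
\<close>

definition hermitian_product ::
    "(complex \<Rightarrow> 'v \<Rightarrow> 'v) \<Rightarrow> 'v::ab_group_add set \<Rightarrow> ('v \<Rightarrow> 'v \<Rightarrow> complex) \<Rightarrow> bool" where
  "hermitian_product smul V t \<longleftrightarrow>
     (\<forall>u\<in>V. \<forall>v\<in>V. \<forall>w\<in>V. t (u + v) w = t u w + t v w) \<and>
     (\<forall>a. \<forall>u\<in>V. \<forall>w\<in>V. t (smul a u) w = a * t u w) \<and>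
     (\<forall>u\<in>V. \<forall>w\<in>V. t w u = cnj (t u w)) \<and>
     (\<forall>u\<in>V. u \<noteq> 0 \<longrightarrow> Re (t u u) > 0)"

definition fscale :: "complex \<Rightarrow> (real^'d \<Rightarrow> complex) \<Rightarrow> (real^'d \<Rightarrow> complex)" where
  "fscale a v = (\<lambda>x. a * v x)"

definition tscale ::
    "complex \<Rightarrow> (nat \<Rightarrow> real^'d \<Rightarrow> complex) \<Rightarrow> (nat \<Rightarrow> real^'d \<Rightarrow> complex)" where
  "tscale a p = (\<lambda>j. fscale a (p j))"

definition diagonal_impedance ::
    "(real^'d) set \<Rightarrow> (real^'d) set set \<Rightarrow> nat \<Rightarrow> nat \<Rightarrow> (nat \<Rightarrow> (real^'d) set)
      \<Rightarrow> ((nat \<Rightarrow> real^'d \<Rightarrow> complex) \<Rightarrow> (nat \<Rightarrow> real^'d \<Rightarrow> complex) \<Rightarrow> complex) \<Rightarrow> bool" where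
  "diagonal_impedance \<Omega> \<T> r J \<Gamma> t \<longleftrightarrow>
     (\<exists>tj. (\<forall>j\<in>{1..J}. hermitian_product fscale (Vh_on \<Omega> \<T> r (\<Gamma> j)) (tj j)) \<and>
        (\<forall>p\<in>multi_trace \<Omega> \<T> r J \<Gamma>. \<forall>q\<in>multi_trace \<Omega> \<T> r J \<Gamma>.
           t p q = (\<Sum>j\<in>{1..J}. tj j (p j) (q j))))"

definition orthogonal_projector ::
    "('v::ab_group_add \<Rightarrow> 'v \<Rightarrow> complex) \<Rightarrow> 'v set \<Rightarrow> 'v set \<Rightarrow> ('v \<Rightarrow> 'v) \<Rightarrow> bool" where
  "orthogonal_projector t V S P \<longleftrightarrow>
     (\<forall>p\<in>V. P p \<in> S \<and> (\<forall>q\<in>S. t (p - P p) q = 0))"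

definition exchange_operator ::
    "(real^'d) set \<Rightarrow> (real^'d) set set \<Rightarrow> nat \<Rightarrow> nat \<Rightarrow> (nat \<Rightarrow> (real^'d) set)
      \<Rightarrow> ((nat \<Rightarrow> real^'d \<Rightarrow> complex) \<Rightarrow> (nat \<Rightarrow> real^'d \<Rightarrow> complex) \<Rightarrow> complex)
      \<Rightarrow> ((nat \<Rightarrow> real^'d \<Rightarrow> complex) \<Rightarrow> (nat \<Rightarrow> real^'d \<Rightarrow> complex)) \<Rightarrow> bool" where
  "exchange_operator \<Omega> \<T> r J \<Gamma> t Exch \<longleftrightarrow>
     Exch \<in> multi_trace \<Omega> \<T> r J \<Gamma> \<rightarrow> multi_trace \<Omega> \<T> r J \<Gamma> \<and>
     orthogonal_projector t (multi_trace \<Omega> \<T> r J \<Gamma>) (single_trace \<Omega> \<T> r J \<Gamma>)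
       (\<lambda>p. tscale (1/2) (p + Exch p))"

definition swap_operator ::
    "(real^'d) set \<Rightarrow> (real^'d) set set \<Rightarrow> nat \<Rightarrow> nat \<Rightarrow> (nat \<Rightarrow> (real^'d) set)
      \<Rightarrow> ((nat \<Rightarrow> real^'d \<Rightarrow> complex) \<Rightarrow> (nat \<Rightarrow> real^'d \<Rightarrow> complex)) \<Rightarrow> bool" where
  "swap_operator \<Omega> \<T> r J \<Gamma> X \<longleftrightarrow>
     X \<in> multi_trace \<Omega> \<T> r J \<Gamma> \<rightarrow> multi_trace \<Omega> \<T> r J \<Gamma> \<and>
     (\<forall>v\<in>multi_trace \<Omega> \<T> r J \<Gamma>. \<forall>w\<in>multi_trace \<Omega> \<T> r J \<Gamma>.
        v = X w \<longleftrightarrow>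
          (\<forall>j\<in>{1..J}. \<forall>k\<in>{1..J}. j \<noteq> k \<longrightarrow> (\<forall>x\<in>\<Gamma> j \<inter> \<Gamma> k. v j x = w k x)) \<and>
          (\<forall>j\<in>{1..J}. \<forall>x\<in>\<Gamma> j \<inter> \<Gamma> 0. v j x = w j x))"

end

theory Submission
  imports Defs
begin

text \<open>
  An orthogonal projector onto a subspace is unique, so it suffices to show that
  \<open>(Id + X) / 2\<close> is also the \<open>t\<close>-orthogonal projector onto the single traces: then
  \<open>w + X w = w + Exch w\<close> for every multi-trace \<open>w\<close>.  Two properties have to be checked.

  \<^item> Range.  On the interface of \<open>\<Omega>\<^sub>j\<close> and \<open>\<Omega>\<^sub>k\<close> both components of \<open>(w + X w) / 2\<close> equal the
    average of \<open>w\<^sub>j\<close> and \<open>w\<^sub>k\<close>.  A tuple of traces that match on all interfaces is the trace of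
    one finite element function (\<open>single_trace_of_matching\<close>): extend each component to its
    closed subdomain and paste.  The closed subdomains overlap only in the interfaces, so the
    pasted function is well defined and continuous; it is polynomial on every cell because
    every cell lies inside one closed subdomain.

  \<^item> Orthogonality.  The defect \<open>(w - X w) / 2\<close> vanishes on \<open>\<partial>\<Omega>\<close>, and its two values on an
    interface are opposite to each other, whereas a single trace takes the same value from both
    sides.  Since the impedance weighs both sides of an interface by the same scalar product,
    the two contributions of each interface cancel.
\<close>


section \<open>Scalar products and orthogonal projectors\<close>

lemma hermitian_product_add_left:
  assumes "hermitian_product smul V s" "u \<in> V" "v \<in> V" "w \<in> V"
  shows "s (u + v) w = s u w + s v w"
proof -
  have "\<forall>u\<in>V. \<forall>v\<in>V. \<forall>w\<in>V. s (u + v) w = s u w + s v w"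
    using assms(1) unfolding hermitian_product_def by (elim conjE)
  then show ?thesis
    using assms(2-4) by blast
qed

lemma hermitian_product_positive:
  assumes "hermitian_product smul V s" "u \<in> V" "u \<noteq> 0"
  shows "Re (s u u) > 0"
proof -
  have "\<forall>u\<in>V. u \<noteq> 0 \<longrightarrow> Re (s u u) > 0"
    using assms(1) unfolding hermitian_product_def by (elim conjE)
  then show ?thesis
    using assms(2,3) by blast
qed

lemma hermitian_product_zero_left:
  assumes "hermitian_product smul V s" "u \<in> V" "w \<in> V" "smul 0 u = 0"
  shows "s 0 w = 0"
  using assms unfolding hermitian_product_def by (metis mult_zero_left)

text \<open>
  This is how an interface disappears from the impedance: \<open>a\<close> and \<open>b\<close> stand for the two opposite
  values of the defect, \<open>w\<close> for the common value of the test trace.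
\<close>

lemma hermitian_product_opposite_cancel:
  assumes s: "hermitian_product smul V s" and V: "a \<in> V" "b \<in> V" "w \<in> V"
    and "smul 0 a = 0" and "a + b = 0"
  shows "s a w + s b w = 0"
proof -
  have "s a w + s b w = s 0 w"
    using hermitian_product_add_left[OF s V] \<open>a + b = 0\<close> by simp
  also have "\<dots> = 0"
    using hermitian_product_zero_left[OF s V(1,3)] \<open>smul 0 a = 0\<close> .
  finally show ?thesis .
qed

text \<open>
  The difference of two candidate projections of the same vector lies in the subspace and is
  orthogonal to it, hence to itself.
\<close>

lemma orthogonal_projector_unique:
  assumes t: "hermitian_product smul V t"
    and V: "\<And>u v. u \<in> V \<Longrightarrow> v \<in> V \<Longrightarrow> u - v \<in> V"
    and S: "\<And>u v. u \<in> S \<Longrightarrow> v \<in> S \<Longrightarrow> u - v \<in> S" and "S \<subseteq> V"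
    and P: "orthogonal_projector t V S P" and Q: "orthogonal_projector t V S Q"
    and p: "p \<in> V"
  shows "P p = Q p"
proof (rule ccontr)
  assume ne: "P p \<noteq> Q p"
  let ?e = "P p - Q p"
  have PQ: "P p \<in> S" "Q p \<in> S" and orth: "\<forall>q\<in>S. t (p - P p) q = 0" "\<forall>q\<in>S. t (p - Q p) q = 0"
    using P Q p unfolding orthogonal_projector_def by auto
  have e: "?e \<in> S" "?e \<in> V" "p - P p \<in> V"
    using S[OF PQ] V[OF p] PQ \<open>S \<subseteq> V\<close> by blast+
  have "t (?e + (p - P p)) ?e = t ?e ?e + t (p - P p) ?e"
    using hermitian_product_add_left[OF t e(2,3,2)] .
  moreover have "?e + (p - P p) = p - Q p" by simp
  ultimately have "t ?e ?e = 0"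
    using bspec[OF orth(1) e(1)] bspec[OF orth(2) e(1)] by simp
  moreover have "Re (t ?e ?e) > 0"
    using hermitian_product_positive[OF t e(2)] ne by simp
  ultimately show False by simp
qed


section \<open>The trace spaces are complex vector spaces\<close>

interpretation fn: vector_space "fscale :: complex \<Rightarrow> (real^'d \<Rightarrow> complex) \<Rightarrow> _"
  by unfold_locales (auto simp: fscale_def fun_eq_iff algebra_simps)

interpretation tup: vector_space "tscale :: complex \<Rightarrow> (nat \<Rightarrow> real^'d \<Rightarrow> complex) \<Rightarrow> _"
  by unfold_locales (auto simp: tscale_def fscale_def fun_eq_iff algebra_simps)

lemma restr_restr [simp]: "restr A (restr B v) = restr (A \<inter> B) v"
  by (auto simp: restr_def)

lemma subspace_poly_deg_le: "fn.subspace {p. poly_deg_le r p}"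
proof (rule fn.subspaceI; unfold mem_Collect_eq)
  show "poly_deg_le r 0"
    unfolding poly_deg_le_def by (intro exI[of _ "\<lambda>_. 0"]) simp
next
  fix p q :: "real^'d \<Rightarrow> complex"
  assume "poly_deg_le r p" "poly_deg_le r q"
  then obtain c c' where
    p: "\<forall>x. p x = (\<Sum>\<alpha> | (\<Sum>i\<in>UNIV. \<alpha> i) \<le> r. c \<alpha> * (\<Prod>i\<in>UNIV. complex_of_real (x $ i) ^ \<alpha> i))" and
    q: "\<forall>x. q x = (\<Sum>\<alpha> | (\<Sum>i\<in>UNIV. \<alpha> i) \<le> r. c' \<alpha> * (\<Prod>i\<in>UNIV. complex_of_real (x $ i) ^ \<alpha> i))"
    unfolding poly_deg_le_def by (elim exE)
  show "poly_deg_le r (p + q)"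
    unfolding poly_deg_le_def
    by (intro exI[of _ "\<lambda>\<alpha>. c \<alpha> + c' \<alpha>"] allI)
      (simp only: plus_fun_apply p[rule_format] q[rule_format] sum.distrib distrib_right)
next
  fix a and p :: "real^'d \<Rightarrow> complex"
  assume "poly_deg_le r p"
  then obtain c where
    p: "\<forall>x. p x = (\<Sum>\<alpha> | (\<Sum>i\<in>UNIV. \<alpha> i) \<le> r. c \<alpha> * (\<Prod>i\<in>UNIV. complex_of_real (x $ i) ^ \<alpha> i))"
    unfolding poly_deg_le_def by (elim exE)
  show "poly_deg_le r (fscale a p)"
    unfolding poly_deg_le_def fscale_def
    by (intro exI[of _ "\<lambda>\<alpha>. a * c \<alpha>"] allI)
      (simp only: p[rule_format] sum_distrib_left mult.assoc)
qed

lemma VhI: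
  assumes "continuous_on (closure \<Omega>) v"
    and "\<And>T. T \<in> \<T> \<Longrightarrow> \<exists>p. poly_deg_le r p \<and> (\<forall>x\<in>T. v x = p x)"
    and "\<And>x. x \<notin> closure \<Omega> \<Longrightarrow> v x = 0"
  shows "v \<in> Vh \<Omega> \<T> r"
  unfolding Vh_def mem_Collect_eq by (intro conjI ballI allI impI assms)

lemma VhD:
  assumes "v \<in> Vh \<Omega> \<T> r"
  shows Vh_continuous: "continuous_on (closure \<Omega>) v"
    and Vh_polynomial: "\<forall>T\<in>\<T>. \<exists>p. poly_deg_le r p \<and> (\<forall>x\<in>T. v x = p x)"
    and Vh_outside: "\<forall>x. x \<notin> closure \<Omega> \<longrightarrow> v x = 0"
  using assms unfolding Vh_def mem_Collect_eq by simp_all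

lemma Vh_polynomialE:
  assumes "v \<in> Vh \<Omega> \<T> r" "T \<in> \<T>"
  obtains p where "poly_deg_le r p" "\<And>x. x \<in> T \<Longrightarrow> v x = p x"
  using bspec[OF Vh_polynomial[OF assms(1)] assms(2)] by (elim exE conjE) (rule that, simp_all)

lemma subspace_Vh:
  fixes \<Omega> :: "(real^'d) set"
  shows "fn.subspace (Vh \<Omega> \<T> r)"
proof (rule fn.subspaceI)
  have "poly_deg_le r (0 :: real^'d \<Rightarrow> complex)"
    using fn.subspace_0[OF subspace_poly_deg_le, of r] by simp
  moreover have "continuous_on (closure \<Omega>) (0 :: real^'d \<Rightarrow> complex)"
    unfolding zero_fun_def by (rule continuous_on_const)
  ultimately show "0 \<in> Vh \<Omega> \<T> r"
    by (intro VhI exI[of _ "0 :: real^'d \<Rightarrow> complex"]) simp_all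
next
  fix u v :: "real^'d \<Rightarrow> complex"
  assume u: "u \<in> Vh \<Omega> \<T> r" and v: "v \<in> Vh \<Omega> \<T> r"
  show "u + v \<in> Vh \<Omega> \<T> r"
  proof (rule VhI)
    show "continuous_on (closure \<Omega>) (u + v)"
      unfolding plus_fun_def by (intro continuous_on_add Vh_continuous[OF u] Vh_continuous[OF v])
    fix T assume T: "T \<in> \<T>"
    obtain p where p: "poly_deg_le r p" "\<And>x. x \<in> T \<Longrightarrow> u x = p x"
      using Vh_polynomialE[OF u T] by metis
    obtain q where q: "poly_deg_le r q" "\<And>x. x \<in> T \<Longrightarrow> v x = q x"
      using Vh_polynomialE[OF v T] by metis
    have "poly_deg_le r (p + q)"
      using fn.subspace_add[OF subspace_poly_deg_le, of p r q] p q by simp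
    then show "\<exists>p. poly_deg_le r p \<and> (\<forall>x\<in>T. (u + v) x = p x)"
      using p(2) q(2) by (intro exI[of _ "p + q"]) simp
  qed (simp add: Vh_outside[OF u] Vh_outside[OF v])
next
  fix a and v :: "real^'d \<Rightarrow> complex"
  assume v: "v \<in> Vh \<Omega> \<T> r"
  show "fscale a v \<in> Vh \<Omega> \<T> r"
  proof (rule VhI)
    show "continuous_on (closure \<Omega>) (fscale a v)"
      unfolding fscale_def by (intro continuous_on_mult_left Vh_continuous[OF v])
    fix T assume T: "T \<in> \<T>"
    obtain p where p: "poly_deg_le r p" "\<And>x. x \<in> T \<Longrightarrow> v x = p x"
      using Vh_polynomialE[OF v T] by metis
    have "poly_deg_le r (fscale a p)"
      using fn.subspace_scale[OF subspace_poly_deg_le, of p r a] p by simp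
    then show "\<exists>p. poly_deg_le r p \<and> (\<forall>x\<in>T. fscale a v x = p x)"
      using p(2) by (intro exI[of _ "fscale a p"]) (simp add: fscale_def)
  qed (simp add: Vh_outside[OF v] fscale_def)
qed

lemma linear_restr: "Vector_Spaces.linear fscale fscale (restr \<Upsilon>)"
  by unfold_locales (auto simp: restr_def fscale_def fun_eq_iff algebra_simps)

lemma subspace_Vh_on: "fn.subspace (Vh_on \<Omega> \<T> r \<Upsilon>)"
  unfolding Vh_on_def
  by (rule module_hom.subspace_image[OF linear_restr[folded module_hom_iff_linear] subspace_Vh])

lemma restr_in_Vh_on:
  assumes "u \<in> Vh_on \<Omega> \<T> r \<Upsilon>" "\<Upsilon>' \<subseteq> \<Upsilon>"
  shows "restr \<Upsilon>' u \<in> Vh_on \<Omega> \<T> r \<Upsilon>'"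
  using assms unfolding Vh_on_def by (auto simp: Int_absorb2)

lemma subspace_multi_trace: "tup.subspace (multi_trace \<Omega> \<T> r J \<Gamma>)"
  using subspace_Vh_on[of \<Omega> \<T> r]
  by (auto simp: tup.subspace_def fn.subspace_def multi_trace_def tscale_def)

lemma subspace_single_trace: "tup.subspace (single_trace \<Omega> \<T> r J \<Gamma>)"
proof -
  have "Vector_Spaces.linear fscale tscale (\<lambda>v j. if j \<in> {1..J} then restr (\<Gamma> j) v else 0)"
    by unfold_locales (auto simp: restr_def tscale_def fscale_def fun_eq_iff algebra_simps)
  then show ?thesis
    unfolding single_trace_def module_hom_iff_linear[symmetric]
    by (rule module_hom.subspace_image[OF _ subspace_Vh])
qed

lemma single_trace_subset_multi_trace: "single_trace \<Omega> \<T> r J \<Gamma> \<subseteq> multi_trace \<Omega> \<T> r J \<Gamma>"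
  unfolding single_trace_def multi_trace_def Vh_on_def by auto

lemma single_trace_matching:
  assumes "q \<in> single_trace \<Omega> \<T> r J \<Gamma>" "j \<in> {1..J}" "k \<in> {1..J}"
  shows "restr (\<Gamma> j \<inter> \<Gamma> k) (q j) = restr (\<Gamma> j \<inter> \<Gamma> k) (q k)"
  using assms unfolding single_trace_def by (auto simp: restr_def)


section \<open>Pasting matching traces\<close>

lemma simplicial_meshD:
  fixes \<Omega> :: "(real^'d) set"
  assumes "simplicial_mesh \<Omega> \<T>"
  shows mesh_simplex: "T \<in> \<T> \<Longrightarrow> int CARD('d) simplex T"
    and mesh_face: "T \<in> \<T> \<Longrightarrow> T' \<in> \<T> \<Longrightarrow> T \<inter> T' face_of T"
    and mesh_cover: "closure \<Omega> = \<Union>\<T>"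
  using assms by (simp_all add: simplicial_mesh_def triangulation_def)

lemma subdomain_partitionD:
  assumes "subdomain_partition \<Omega> \<T> J \<Omega>s"
  shows subdomain_open: "j \<in> {1..J} \<Longrightarrow> open (\<Omega>s j)"
    and subdomain_cells: "j \<in> {1..J} \<Longrightarrow> \<exists>S\<subseteq>\<T>. closure (\<Omega>s j) = \<Union>S"
    and subdomain_disjoint: "j \<in> {1..J} \<Longrightarrow> k \<in> {1..J} \<Longrightarrow> j \<noteq> k \<Longrightarrow> \<Omega>s j \<inter> \<Omega>s k = {}"
    and subdomain_cover: "closure \<Omega> = (\<Union>j\<in>{1..J}. closure (\<Omega>s j))"
  using assms by (simp_all add: subdomain_partition_def polyhedral_open_def)

text \<open>
  A relative interior point of a cell cannot lie on a proper face.  The cells \<open>T\<close> and \<open>T'\<close> meet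
  in a common face, which must then be all of \<open>T\<close>; so \<open>T\<close> is a face of \<open>T'\<close> of the same
  dimension, that is, \<open>T'\<close> itself.
\<close>

lemma mesh_cell_unique_at_rel_interior:
  fixes \<Omega> :: "(real^'d) set"
  assumes mesh: "simplicial_mesh \<Omega> \<T>" and T: "T \<in> \<T>" "T' \<in> \<T>"
    and x: "x \<in> rel_interior T" "x \<in> T'"
  shows "T' = T"
proof (rule ccontr)
  assume "T' \<noteq> T"
  have "x \<in> T"
    using x(1) rel_interior_subset by (rule rev_subsetD)
  then have "T \<inter> T' \<inter> rel_interior T \<noteq> {}"
    using x by blast
  then have "T \<subseteq> T \<inter> T'"
    by (rule subset_of_face_of[OF mesh_face[OF mesh T] subset_refl])
  then have "T' \<inter> T = T"
    by blast
  then have "T face_of T'"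
    using mesh_face[OF mesh T(2,1)] by simp
  then have "aff_dim T < aff_dim T'"
    using face_of_aff_dim_lt[OF convex_simplex[OF mesh_simplex[OF mesh T(2)]], of T] \<open>T' \<noteq> T\<close> by simp
  then show False
    using aff_dim_simplex[OF mesh_simplex[OF mesh T(1)]] aff_dim_simplex[OF mesh_simplex[OF mesh T(2)]]
    by simp
qed

text \<open>
  The subdomain is the one that contains some relative interior point of the cell: among its
  cells there is one through this point, and that is the given cell.
\<close>

lemma mesh_cell_in_subdomain:
  fixes \<Omega> :: "(real^'d) set"
  assumes mesh: "simplicial_mesh \<Omega> \<T>" and part: "subdomain_partition \<Omega> \<T> J \<Omega>s" and T: "T \<in> \<T>"
  obtains j where "j \<in> {1..J}" "T \<subseteq> closure (\<Omega>s j)"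
proof -
  have "T \<noteq> {}"
    using aff_dim_simplex[OF mesh_simplex[OF mesh T]] by auto
  then obtain x where x: "x \<in> rel_interior T"
    using rel_interior_eq_empty[OF convex_simplex[OF mesh_simplex[OF mesh T]]] by blast
  have "x \<in> T"
    using x rel_interior_subset by (rule rev_subsetD)
  then have "x \<in> closure \<Omega>"
    using mesh_cover[OF mesh] T by blast
  then obtain j where j: "j \<in> {1..J}" "x \<in> closure (\<Omega>s j)"
    using subdomain_cover[OF part] by blast
  then obtain S where "S \<subseteq> \<T>" and S: "closure (\<Omega>s j) = \<Union>S"
    using subdomain_cells[OF part] by blast
  then obtain T' where T': "T' \<in> S" "T' \<in> \<T>" "x \<in> T'"
    using j by blast
  then have "T' = T"
    using mesh_cell_unique_at_rel_interior[OF mesh T _ x] by simp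
  then show ?thesis
    using that j(1) T'(1) S by blast
qed

text \<open>Neither of two disjoint open sets meets the closure of the other.\<close>

lemma closure_Int_closure_eq_frontier:
  assumes "open A" "open B" "A \<inter> B = {}"
  shows "closure A \<inter> closure B = frontier A \<inter> frontier B"
  using assms open_Int_closure_eq_empty[of A B] open_Int_closure_eq_empty[of B A]
  by (auto simp: frontier_def interior_open)

text \<open>
  Each \<open>u j\<close> extends to some \<open>V j\<close> in the finite element space, and \<open>v\<close> is defined to be \<open>V j\<close> on the
  \<open>j\<close>-th closed subdomain.  Where two closed subdomains overlap they only share boundary points,
  and there the hypothesis makes the two prescriptions agree.  Hence \<open>v\<close> is continuous by pasting
  over a finite closed cover, and it is polynomial on each cell, since it agrees there with a
  single \<open>V j\<close>.
\<close>

lemma single_trace_of_matching: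
  fixes \<Omega> :: "(real^'d) set"
  assumes mesh: "simplicial_mesh \<Omega> \<T>" and part: "subdomain_partition \<Omega> \<T> J \<Omega>s"
    and \<Gamma>: "\<Gamma> = bdry \<Omega> \<Omega>s"
    and u: "u \<in> multi_trace \<Omega> \<T> r J \<Gamma>"
    and match: "\<And>j k x. j \<in> {1..J} \<Longrightarrow> k \<in> {1..J} \<Longrightarrow> j \<noteq> k \<Longrightarrow> x \<in> \<Gamma> j \<inter> \<Gamma> k \<Longrightarrow> u j x = u k x"
  shows "u \<in> single_trace \<Omega> \<T> r J \<Gamma>"
proof -
  have \<Gamma>j: "\<Gamma> j = frontier (\<Omega>s j)" if "j \<in> {1..J}" for j
    using that unfolding \<Gamma> bdry_def by auto
  have cover: "closure \<Omega> = (\<Union>j\<in>{1..J}. closure (\<Omega>s j))"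
    using subdomain_cover[OF part] .
  have "\<forall>j\<in>{1..J}. \<exists>v\<in>Vh \<Omega> \<T> r. u j = restr (\<Gamma> j) v"
    using u unfolding multi_trace_def Vh_on_def by blast
  then obtain V where V: "\<And>j. j \<in> {1..J} \<Longrightarrow> V j \<in> Vh \<Omega> \<T> r"
    and uV: "\<And>j. j \<in> {1..J} \<Longrightarrow> u j = restr (\<Gamma> j) (V j)"
    by metis
  have overlap: "V j x = V k x"
    if jk: "j \<in> {1..J}" "k \<in> {1..J}" and x: "x \<in> closure (\<Omega>s j)" "x \<in> closure (\<Omega>s k)" for j k x
  proof (cases "j = k")
    case False
    have "closure (\<Omega>s j) \<inter> closure (\<Omega>s k) = \<Gamma> j \<inter> \<Gamma> k"
      unfolding \<Gamma>j[OF jk(1)] \<Gamma>j[OF jk(2)] using jk False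
      by (intro closure_Int_closure_eq_frontier subdomain_open[OF part] subdomain_disjoint[OF part])
    then have "x \<in> \<Gamma> j \<inter> \<Gamma> k"
      using x by blast
    then show ?thesis
      using match[OF jk False, of x] jk uV by (auto simp: restr_def)
  qed simp
  \<comment> \<open>By the agreement on overlaps, any choice among the subdomains around \<open>x\<close> gives the same value.\<close>
  define v where
    "v x = (if x \<in> closure \<Omega> then V (SOME j. j \<in> {1..J} \<and> x \<in> closure (\<Omega>s j)) x else 0)" for x
  have v: "v x = V j x" if "j \<in> {1..J}" "x \<in> closure (\<Omega>s j)" for j x
  proof -
    let ?P = "\<lambda>i. i \<in> {1..J} \<and> x \<in> closure (\<Omega>s i)"
    have "?P j"
      using that by (rule conjI)
    then have "?P (SOME i. ?P i)"
      by (rule someI)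
    then have "V (SOME i. ?P i) x = V j x"
      by (elim conjE) (rule overlap[OF _ that(1) _ that(2)])
    moreover have "x \<in> closure \<Omega>"
      using that cover by blast
    ultimately show ?thesis
      unfolding v_def by (simp only: if_True)
  qed
  have "continuous_on (closure (\<Omega>s j)) v" if "j \<in> {1..J}" for j
  proof -
    have "continuous_on (closure (\<Omega>s j)) (V j)"
      using Vh_continuous[OF V[OF that]] that cover by (blast intro: continuous_on_subset)
    then show ?thesis
      using v[OF that] by (simp cong: continuous_on_cong)
  qed
  then have "continuous_on (closure \<Omega>) v"
    unfolding cover by (intro continuous_on_closed_Union) simp_all
  moreover have "\<exists>p. poly_deg_le r p \<and> (\<forall>x\<in>T. v x = p x)" if "T \<in> \<T>" for T
  proof -
    obtain j where j: "j \<in> {1..J}" "T \<subseteq> closure (\<Omega>s j)"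
      using mesh_cell_in_subdomain[OF mesh part \<open>T \<in> \<T>\<close>] .
    obtain p where p: "poly_deg_le r p" "\<And>x. x \<in> T \<Longrightarrow> V j x = p x"
      using Vh_polynomialE[OF V[OF j(1)] \<open>T \<in> \<T>\<close>] by metis
    have "v x = p x" if "x \<in> T" for x
      using v[of j x] p(2) j that by auto
    with p(1) show ?thesis by blast
  qed
  moreover have "v x = 0" if "x \<notin> closure \<Omega>" for x
    unfolding v_def using that by (simp only: if_False)
  ultimately have vVh: "v \<in> Vh \<Omega> \<T> r"
    by (rule VhI)
  have "u j = (if j \<in> {1..J} then restr (\<Gamma> j) v else 0)" for j
  proof (cases "j \<in> {1..J}")
    case True
    then have "v x = V j x" if "x \<in> \<Gamma> j" for x
      using that v \<Gamma>j by (auto simp: frontier_def)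
    then show ?thesis
      using True uV by (auto simp: restr_def)
  qed (use u in \<open>auto simp: multi_trace_def\<close>)
  then show ?thesis
    using vVh unfolding single_trace_def by (auto simp: image_iff fun_eq_iff)
qed


section \<open>Orthogonality and the exchange operator\<close>

text \<open>
  The multi-trace \<open>d\<close> models the defect of the averaging \<open>(Id + X) / 2\<close>: it vanishes on the exterior
  boundary and is antisymmetric across interfaces.  Single traces are symmetric across
  interfaces, so an impedance that treats both sides alike makes the two kinds orthogonal.
\<close>

lemma interface_impedance_orthogonal:
  fixes \<Omega> :: "(real^'d) set"
  assumes s0: "\<And>k. k \<in> {1..J} \<Longrightarrow> hermitian_product fscale (Vh_on \<Omega> \<T> r (\<Gamma> 0 \<inter> \<Gamma> k)) (s 0 k)"
    and s: "\<And>j k. (j, k) \<in> interface_pairs J \<Gamma> \<Longrightarrow>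
        hermitian_product fscale (Vh_on \<Omega> \<T> r (\<Gamma> j \<inter> \<Gamma> k)) (s j k)"
    and d: "d \<in> multi_trace \<Omega> \<T> r J \<Gamma>" and q: "q \<in> single_trace \<Omega> \<T> r J \<Gamma>"
    and d0: "\<And>k x. k \<in> {1..J} \<Longrightarrow> x \<in> \<Gamma> k \<inter> \<Gamma> 0 \<Longrightarrow> d k x = 0"
    and opp: "\<And>j k x. j \<in> {1..J} \<Longrightarrow> k \<in> {1..J} \<Longrightarrow> j \<noteq> k \<Longrightarrow> x \<in> \<Gamma> j \<inter> \<Gamma> k \<Longrightarrow> d j x + d k x = 0"
  shows "(\<Sum>k\<in>{1..J}. s 0 k (restr (\<Gamma> 0 \<inter> \<Gamma> k) (d k)) (restr (\<Gamma> 0 \<inter> \<Gamma> k) (q k))) +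
     (\<Sum>(j, k)\<in>interface_pairs J \<Gamma>.
        s j k (restr (\<Gamma> j \<inter> \<Gamma> k) (d j)) (restr (\<Gamma> j \<inter> \<Gamma> k) (q j)) +
        s j k (restr (\<Gamma> j \<inter> \<Gamma> k) (d k)) (restr (\<Gamma> j \<inter> \<Gamma> k) (q k))) = 0"
proof -
  have trace: "restr \<Upsilon> (p k) \<in> Vh_on \<Omega> \<T> r \<Upsilon>"
    if "p \<in> multi_trace \<Omega> \<T> r J \<Gamma>" "k \<in> {1..J}" "\<Upsilon> \<subseteq> \<Gamma> k" for p k \<Upsilon>
    using that by (auto simp: multi_trace_def intro: restr_in_Vh_on)
  have qm: "q \<in> multi_trace \<Omega> \<T> r J \<Gamma>"
    using q single_trace_subset_multi_trace by blast
  have "s 0 k (restr (\<Gamma> 0 \<inter> \<Gamma> k) (d k)) (restr (\<Gamma> 0 \<inter> \<Gamma> k) (q k)) = 0" if k: "k \<in> {1..J}" for k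
  proof -
    have "restr (\<Gamma> 0 \<inter> \<Gamma> k) (d k) = 0"
      using d0[OF k] by (auto simp: restr_def)
    moreover have "s 0 k 0 (restr (\<Gamma> 0 \<inter> \<Gamma> k) (q k)) = 0"
      by (rule hermitian_product_zero_left[OF s0[OF k] trace[OF d k] trace[OF qm k]]) auto
    ultimately show ?thesis by simp
  qed
  moreover have "s j k (restr (\<Gamma> j \<inter> \<Gamma> k) (d j)) (restr (\<Gamma> j \<inter> \<Gamma> k) (q j)) +
      s j k (restr (\<Gamma> j \<inter> \<Gamma> k) (d k)) (restr (\<Gamma> j \<inter> \<Gamma> k) (q k)) = 0"
    if jk: "(j, k) \<in> interface_pairs J \<Gamma>" for j k
  proof -
    have j: "j \<in> {1..J}" and k: "k \<in> {1..J}" and "j \<noteq> k"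
      using jk by (auto simp: interface_pairs_def)
    have "restr (\<Gamma> j \<inter> \<Gamma> k) (d j) + restr (\<Gamma> j \<inter> \<Gamma> k) (d k) = 0"
      using opp[OF j k \<open>j \<noteq> k\<close>] by (auto simp: restr_def fun_eq_iff)
    then show ?thesis
      unfolding single_trace_matching[OF q j k]
      by (intro hermitian_product_opposite_cancel[OF s[OF jk]] trace d qm j k) auto
  qed
  ultimately show ?thesis
    by (auto intro!: sum.neutral)
qed

theorem proposition12p2:
  fixes \<Omega> :: "(real^'d) set"
    and \<T> :: "(real^'d) set set"
    and r J :: nat
    and \<Omega>s \<Gamma> :: "nat \<Rightarrow> (real^'d) set"
    and t :: "(nat \<Rightarrow> real^'d \<Rightarrow> complex) \<Rightarrow> (nat \<Rightarrow> real^'d \<Rightarrow> complex) \<Rightarrow> complex"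
    and Exch X :: "(nat \<Rightarrow> real^'d \<Rightarrow> complex) \<Rightarrow> (nat \<Rightarrow> real^'d \<Rightarrow> complex)"
  assumes "CARD('d) \<in> {1, 2, 3}"
    and "r \<ge> 1"
    and "polyhedral_open \<Omega>" and "connected \<Omega>"
    and "simplicial_mesh \<Omega> \<T>"
    and "subdomain_partition \<Omega> \<T> J \<Omega>s"
    and "\<Gamma> = bdry \<Omega> \<Omega>s"
    and "no_cross_point J \<Gamma>"
    and "hermitian_product tscale (multi_trace \<Omega> \<T> r J \<Gamma>) t"
    and "diagonal_impedance \<Omega> \<T> r J \<Gamma> t"
    and "exchange_operator \<Omega> \<T> r J \<Gamma> t Exch"
    and "swap_operator \<Omega> \<T> r J \<Gamma> X"
    and "\<exists>s :: nat \<Rightarrow> nat \<Rightarrow> (real^'d \<Rightarrow> complex) \<Rightarrow> (real^'d \<Rightarrow> complex) \<Rightarrow> complex.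
           (\<forall>k\<in>{1..J}. hermitian_product fscale (Vh_on \<Omega> \<T> r (\<Gamma> 0 \<inter> \<Gamma> k)) (s 0 k)) \<and>
           (\<forall>(j, k)\<in>interface_pairs J \<Gamma>.
              hermitian_product fscale (Vh_on \<Omega> \<T> r (\<Gamma> j \<inter> \<Gamma> k)) (s j k)) \<and>
           (\<forall>v\<in>multi_trace \<Omega> \<T> r J \<Gamma>. \<forall>w\<in>multi_trace \<Omega> \<T> r J \<Gamma>.
              t v w =
                (\<Sum>k\<in>{1..J}. s 0 k (restr (\<Gamma> 0 \<inter> \<Gamma> k) (v k)) (restr (\<Gamma> 0 \<inter> \<Gamma> k) (w k))) +
                (\<Sum>(j, k)\<in>interface_pairs J \<Gamma>.
                   s j k (restr (\<Gamma> j \<inter> \<Gamma> k) (v j)) (restr (\<Gamma> j \<inter> \<Gamma> k) (w j)) +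
                   s j k (restr (\<Gamma> j \<inter> \<Gamma> k) (v k)) (restr (\<Gamma> j \<inter> \<Gamma> k) (w k))))"
  shows "\<forall>w\<in>multi_trace \<Omega> \<T> r J \<Gamma>. X w = Exch w"
proof
  let ?M = "multi_trace \<Omega> \<T> r J \<Gamma>" and ?S = "single_trace \<Omega> \<T> r J \<Gamma>"
  fix w assume w: "w \<in> ?M"
  obtain s :: "nat \<Rightarrow> nat \<Rightarrow> (real^'d \<Rightarrow> complex) \<Rightarrow> (real^'d \<Rightarrow> complex) \<Rightarrow> complex"
    where s0: "\<forall>k\<in>{1..J}. hermitian_product fscale (Vh_on \<Omega> \<T> r (\<Gamma> 0 \<inter> \<Gamma> k)) (s 0 k)"
    and s: "\<forall>(j, k)\<in>interface_pairs J \<Gamma>.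
      hermitian_product fscale (Vh_on \<Omega> \<T> r (\<Gamma> j \<inter> \<Gamma> k)) (s j k)"
    and ts: "\<forall>v\<in>?M. \<forall>w\<in>?M. t v w =
        (\<Sum>k\<in>{1..J}. s 0 k (restr (\<Gamma> 0 \<inter> \<Gamma> k) (v k)) (restr (\<Gamma> 0 \<inter> \<Gamma> k) (w k))) +
        (\<Sum>(j, k)\<in>interface_pairs J \<Gamma>.
           s j k (restr (\<Gamma> j \<inter> \<Gamma> k) (v j)) (restr (\<Gamma> j \<inter> \<Gamma> k) (w j)) +
           s j k (restr (\<Gamma> j \<inter> \<Gamma> k) (v k)) (restr (\<Gamma> j \<inter> \<Gamma> k) (w k)))"
    using assms(13) by (elim exE conjE)
  have PX: "orthogonal_projector t ?M ?S (\<lambda>p. tscale (1/2) (p + X p))"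
    unfolding orthogonal_projector_def
  proof (intro ballI conjI)
    fix p assume p: "p \<in> ?M"
    have Xp: "X p \<in> ?M"
      using assms(12) p unfolding swap_operator_def by blast
    have X: "X p j x = p k x" if "j \<in> {1..J}" "k \<in> {1..J}" "j \<noteq> k" "x \<in> \<Gamma> j \<inter> \<Gamma> k" for j k x
      using assms(12) p Xp that unfolding swap_operator_def by blast
    have X0: "X p j x = p j x" if "j \<in> {1..J}" "x \<in> \<Gamma> j \<inter> \<Gamma> 0" for j x
      using assms(12) p Xp that unfolding swap_operator_def by blast
    have avg: "tscale (1/2) (p + X p) \<in> ?M"
      using subspace_multi_trace p Xp by (intro tup.subspace_scale tup.subspace_add)
    show "tscale (1/2) (p + X p) \<in> ?S"
    proof (rule single_trace_of_matching[OF assms(5-7) avg])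
      fix j k x assume "j \<in> {1..J}" "k \<in> {1..J}" "j \<noteq> k" "x \<in> \<Gamma> j \<inter> \<Gamma> k"
      then show "tscale (1/2) (p + X p) j x = tscale (1/2) (p + X p) k x"
        using X[of j k x] X[of k j x] by (simp add: tscale_def fscale_def)
    qed
    fix q assume q: "q \<in> ?S"
    let ?d = "p - tscale (1/2) (p + X p)"
    have d: "?d \<in> ?M"
      using subspace_multi_trace p avg by (rule tup.subspace_diff)
    have qM: "q \<in> ?M"
      using q single_trace_subset_multi_trace by blast
    show "t ?d q = 0"
      unfolding bspec[OF bspec[OF ts d] qM]
    proof (rule interface_impedance_orthogonal[OF _ _ d q])
      show "hermitian_product fscale (Vh_on \<Omega> \<T> r (\<Gamma> 0 \<inter> \<Gamma> k)) (s 0 k)"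
        if "k \<in> {1..J}" for k
        using bspec[OF s0 that] .
      show "hermitian_product fscale (Vh_on \<Omega> \<T> r (\<Gamma> j \<inter> \<Gamma> k)) (s j k)"
        if "(j, k) \<in> interface_pairs J \<Gamma>" for j k
        using bspec[OF s that] by simp
    next
      fix k x assume "k \<in> {1..J}" "x \<in> \<Gamma> k \<inter> \<Gamma> 0"
      then show "?d k x = 0"
        using X0[of k x] by (simp add: tscale_def fscale_def)
    next
      fix j k x assume "j \<in> {1..J}" "k \<in> {1..J}" "j \<noteq> k" "x \<in> \<Gamma> j \<inter> \<Gamma> k"
      then show "?d j x + ?d k x = 0"
        using X[of j k x] X[of k j x] by (simp add: tscale_def fscale_def field_simps)
    qed
  qed
  have PE: "orthogonal_projector t ?M ?S (\<lambda>p. tscale (1/2) (p + Exch p))"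
    using assms(11) unfolding exchange_operator_def by (elim conjE)
  have "tscale (1/2) (w + X w) = tscale (1/2) (w + Exch w)"
    by (rule orthogonal_projector_unique[OF assms(9) tup.subspace_diff[OF subspace_multi_trace]
          tup.subspace_diff[OF subspace_single_trace] single_trace_subset_multi_trace PX PE w])
  then show "X w = Exch w"
    by (simp add: tup.scale_left_imp_eq)
qed

end
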